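(* Let $T_p$ be the triangle with a pendant edge (the graph on vertices $a,b,c,d$ with edges $ab,bc,bd,cd$). Then $g(n,T_p)=n^{o(1)}$ as $n\to\infty$.
   Context: For a positive integer $n$ and a graph $H$: for each vertex $v$ of the complete graph $K_n$ let $f_v$ be a (not necessarily proper) colouring of the edges of the same $K_n$. The collection $\{f_v\}$ is called $(n,H)$-local if for every copy $T$ of $H$ in $K_n$ (i.e. every subgraph of $K_n$ isomorphic to $H$), there exists a vertex $u\in V(T)$ such that all edges of $T$ receive pairwise different colours in $f_u$. $g(n,H)$ is the smallest $k$ for which there is an $(n,H)$-local collection of colourings each using at most $k$ colours. *)

theory Defs
  imports Complex_Main "HOL-Library.Landau_Symbols"
begin

record 'a sgraph =
  verts :: "'a set"
  edges :: "'a set set"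

definition simple_graph :: "'a sgraph \<Rightarrow> bool" where
  "simple_graph G \<longleftrightarrow> (\<forall>e\<in>edges G. e \<subseteq> verts G \<and> card e = 2)"

definition subgraph :: "'a sgraph \<Rightarrow> 'a sgraph \<Rightarrow> bool" where
  "subgraph T G \<longleftrightarrow> simple_graph T \<and> verts T \<subseteq> verts G \<and> edges T \<subseteq> edges G"

definition isomorphic :: "'a sgraph \<Rightarrow> 'b sgraph \<Rightarrow> bool" where
  "isomorphic G H \<longleftrightarrow>
     (\<exists>\<phi>. bij_betw \<phi> (verts G) (verts H) \<and>
          (\<forall>x\<in>verts G. \<forall>y\<in>verts G. {x, y} \<in> edges G \<longleftrightarrow> {\<phi> x, \<phi> y} \<in> edges H))"

definition complete_graph :: "nat \<Rightarrow> nat sgraph" where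
  "complete_graph n = \<lparr>verts = {..<n}, edges = {e. e \<subseteq> {..<n} \<and> card e = 2}\<rparr>"

text \<open>
  Triangle \<open>b c d\<close> with pendant edge \<open>a b\<close>, where \<open>a, b, c, d\<close> are encoded as
  \<open>0, 1, 2, 3\<close>.
\<close>

definition T_p :: "nat sgraph" where
  "T_p = \<lparr>verts = {0, 1, 2, 3}, edges = {{0, 1}, {1, 2}, {1, 3}, {2, 3}}\<rparr>"

text \<open>
  Only the values \<open>f v e\<close> for vertices \<open>v\<close> and edges \<open>e\<close> of \<open>K\<^sub>n\<close> are relevant.
  Taking natural numbers as colours is no restriction, as \<open>K\<^sub>n\<close> has finitely many edges.
\<close>

definition local_collection ::
    "nat \<Rightarrow> 'a sgraph \<Rightarrow> (nat \<Rightarrow> nat set \<Rightarrow> nat) \<Rightarrow> bool" where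
  "local_collection n H f \<longleftrightarrow>
     (\<forall>T. subgraph T (complete_graph n) \<and> isomorphic T H \<longrightarrow>
          (\<exists>u\<in>verts T. inj_on (f u) (edges T)))"

text \<open>
  The number of colours is bounded for each colouring separately; different colourings may
  use different palettes.
\<close>

definition g :: "nat \<Rightarrow> 'a sgraph \<Rightarrow> nat" where
  "g n H = (LEAST k. \<exists>f. local_collection n H f \<and>
     (\<forall>v\<in>verts (complete_graph n). card (f v ` edges (complete_graph n)) \<le> k))"

end

theory Submission
  imports Defs "HOL-Library.Countable" "HOL-Computational_Algebra.Polynomial" "HOL-Real_Asymp.Real_Asymp"
begin

text \<open>
  View vertices as binary words of length \<open>L\<close>, about \<open>log\<^sub>2 n\<close>, and let
  \<open>\<delta> x y < L\<close> be the first position where \<open>x\<close> and \<open>y\<close> differ. Also give each vertex \<open>x\<close> a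
  Reed--Solomon type codeword \<open>E x\<close> of length \<open>L\<close> over an alphabet of size \<open>n\<close> to the power
  \<open>1/r + o(1)\<close>, distinct codewords agreeing in at most \<open>r\<close> places. If \<open>x\<close> is the endpoint of
  an edge \<open>xy\<close> closer to \<open>u\<close> in the ultrametric sense, then \<open>f\<^sub>u(xy)\<close> records \<open>\<delta> x y\<close>,
  \<open>\<delta> u x\<close>, the letter of \<open>E y\<close> at \<open>\<delta> u x\<close>, and the bits of \<open>y\<close> at the places where \<open>E u\<close> and
  \<open>E x\<close> agree.

  Consider a triangle \<open>bcd\<close> with pendant edge \<open>ab\<close> on which \<open>a\<close>, \<open>c\<close> and \<open>d\<close> all fail. Comparing
  only values of \<open>\<delta>\<close>, one is left, up to exchanging \<open>c\<close> and \<open>d\<close>, with the first split separating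
  \<open>{a, d}\<close> from \<open>{b, c}\<close>. For \<open>k = \<delta> a d\<close>, the failure of \<open>a\<close> makes \<open>E b\<close> and \<open>E c\<close> agree at
  \<open>k\<close>; so \<open>c\<close> sees bit \<open>k\<close> of the far endpoints of \<open>bd\<close> and \<open>ba\<close>, and its failure makes bit \<open>k\<close>
  of \<open>d\<close> and \<open>a\<close> equal, a contradiction. Letting \<open>r\<close> grow makes the number of colours
  \<open>n\<close> to the power \<open>o(1)\<close>.
\<close>

section \<open>Binary words and the position where two of them split\<close>

definition first_diff :: "nat \<Rightarrow> nat \<Rightarrow> nat" where
  "first_diff x y = (LEAST i. bit x i \<noteq> bit y i)"

lemma first_diff_commute: "first_diff x y = first_diff y x"
  unfolding first_diff_def by metis

lemma bit_first_diff: "x \<noteq> y \<Longrightarrow> bit x (first_diff x y) \<noteq> bit y (first_diff x y)"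
  unfolding first_diff_def by (rule LeastI_ex) (metis bit_eq_iff)

lemma bit_less_first_diff: "i < first_diff x y \<Longrightarrow> bit x i = bit y i"
  unfolding first_diff_def by (blast dest: not_less_Least)

lemma first_diff_eqI:
  "\<lbrakk>bit x i \<noteq> bit y i; \<And>j. j < i \<Longrightarrow> bit x j = bit y j\<rbrakk> \<Longrightarrow> first_diff x y = i"
  unfolding first_diff_def by (rule Least_equality) (auto simp: not_le[symmetric])

lemma first_diff_less:
  assumes "x \<noteq> y" "x < 2 ^ L" "y < 2 ^ L"
  shows "first_diff x y < L"
proof (rule ccontr)
  assume "\<not> first_diff x y < L"
  then have "\<not> bit z (first_diff x y)" if "z < 2 ^ L" for z :: nat
    using that by (metis bit_take_bit_iff take_bit_nat_eq_self_iff)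
  with assms bit_first_diff show False by blast
qed

text \<open>A bit has only two values: \<open>y\<close> and \<open>z\<close> both differ from
  \<open>x\<close> at the split, so they agree there. Hence no three vertices have three equal
  splits.\<close>

lemma first_diff_gt:
  assumes "x \<noteq> y" "x \<noteq> z" "y \<noteq> z" "first_diff x y = first_diff x z"
  shows "first_diff x y < first_diff y z"
proof (rule ccontr)
  assume "\<not> ?thesis"
  then consider "first_diff y z < first_diff x y" | "first_diff y z = first_diff x y"
    by linarith
  then show False
    using assms by cases (metis bit_first_diff bit_less_first_diff)+
qed

lemma first_diff_isosceles:
  assumes "x \<noteq> y" "first_diff x y < first_diff y z"
  shows "first_diff x z = first_diff x y"
  using assms by (intro first_diff_eqI) (metis bit_first_diff bit_less_first_diff less_trans)+

section \<open>A Reed--Solomon type code from base-\<open>B\<close> digits\<close>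

fun digit_poly :: "nat \<Rightarrow> nat \<Rightarrow> nat \<Rightarrow> int poly" where
  "digit_poly B 0 x = 0"
| "digit_poly B (Suc r) x = pCons (int (x mod B)) (digit_poly B r (x div B))"

lemma degree_digit_poly: "degree (digit_poly B r x) \<le> r"
proof (induction r arbitrary: x)
  case (Suc r)
  show ?case
    using degree_pCons_le[of "int (x mod B)" "digit_poly B r (x div B)"] Suc[of "x div B"] by simp
qed simp

lemma digit_poly_inj:
  "\<lbrakk>x < B ^ r; y < B ^ r; digit_poly B r x = digit_poly B r y\<rbrakk> \<Longrightarrow> x = y"
proof (induction r arbitrary: x y)
  case (Suc r)
  have "x div B < B ^ r" "y div B < B ^ r"
    using Suc.prems(1,2) by (simp_all add: less_mult_imp_div_less mult.commute)
  with Suc have "x div B = y div B" "x mod B = y mod B" by auto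
  then show ?case by (metis div_mult_mod_eq)
qed simp

lemma poly_digit_poly_nonneg: "0 \<le> poly (digit_poly B r x) (int j)"
  by (induction r arbitrary: x) auto

text \<open>\<open>Suc j\<close> in place of \<open>j\<close> leaves room for the digit added in
  each Horner step.\<close>

lemma poly_digit_poly_less:
  assumes "0 < B"
  shows "poly (digit_poly B r x) (int j) < int (B * Suc j ^ r)"
proof (induction r arbitrary: x)
  case (Suc r)
  have "int (x mod B) < int B" using assms by simp
  also have "B * 1 \<le> B * Suc j ^ r" by (intro mult_left_mono one_le_power) auto
  then have "int B \<le> int (B * Suc j ^ r)" by (simp only: mult_1_right of_nat_le_iff)
  finally have "int (x mod B) < int (B * Suc j ^ r)" .
  moreover have "int j * poly (digit_poly B r (x div B)) (int j) \<le> int j * int (B * Suc j ^ r)"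
    by (rule mult_left_mono[OF less_imp_le[OF Suc]]) simp
  ultimately show ?case by (simp add: algebra_simps)
qed (use assms in simp)

definition code :: "nat \<Rightarrow> nat \<Rightarrow> nat \<Rightarrow> nat \<Rightarrow> nat" where
  "code B r x j = nat (poly (digit_poly B r x) (int j))"

lemma code_less:
  assumes "0 < B" "j < L"
  shows "code B r x j < B * L ^ r"
proof -
  have "code B r x j < B * Suc j ^ r"
    using poly_digit_poly_less[OF assms(1)] poly_digit_poly_nonneg
    unfolding code_def by (subst nat_less_iff) auto
  also have "\<dots> \<le> B * L ^ r"
    using assms by (intro mult_left_mono power_mono) auto
  finally show ?thesis .
qed

definition agree :: "(nat \<Rightarrow> nat \<Rightarrow> nat) \<Rightarrow> nat \<Rightarrow> nat \<Rightarrow> nat \<Rightarrow> nat set" where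
  "agree E L x y = {j. j < L \<and> E x j = E y j}"

text \<open>Agreements are roots of the difference of two distinct polynomials of degree at most
  \<open>r\<close>.\<close>

lemma card_agree_code:
  assumes "x \<noteq> y" "x < B ^ r" "y < B ^ r"
  shows "card (agree (code B r) L x y) \<le> r"
proof -
  define p where "p = digit_poly B r x - digit_poly B r y"
  have "p \<noteq> 0" using digit_poly_inj assms unfolding p_def by auto
  have "int ` agree (code B r) L x y \<subseteq> {z. poly p z = 0}"
    using poly_digit_poly_nonneg by (auto simp: agree_def code_def p_def eq_nat_nat_iff)
  then have "card (int ` agree (code B r) L x y) \<le> card {z. poly p z = 0}"
    using \<open>p \<noteq> 0\<close> by (intro card_mono poly_roots_finite)
  also have "\<dots> \<le> degree p" using \<open>p \<noteq> 0\<close> by (rule card_poly_roots_bound)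
  also have "\<dots> \<le> r" unfolding p_def by (intro degree_diff_le degree_digit_poly)
  finally show ?thesis by (simp add: card_image)
qed

section \<open>The colouring\<close>

text \<open>
  The bits are listed rather than kept with their positions: for fixed \<open>u\<close> the agreement set
  varies with \<open>x\<close>, and recording it would cost too many colours.
\<close>

definition view :: "(nat \<Rightarrow> nat \<Rightarrow> nat) \<Rightarrow> nat \<Rightarrow> nat \<Rightarrow> nat \<Rightarrow> nat \<Rightarrow> nat \<times> nat \<times> bool list" where
  "view E L u x y =
     (first_diff u x, E y (first_diff u x), map (bit y) (sorted_list_of_set (agree E L u x)))"

text \<open>\<open>Min\<close> and \<open>Max\<close> merely order the pair. On a tie the choice of
  near endpoint is harmless: views are compared only through \<open>colour_view\<close>, which
  assumes strict inequality.\<close>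

definition colour ::
    "(nat \<Rightarrow> nat \<Rightarrow> nat) \<Rightarrow> nat \<Rightarrow> nat \<Rightarrow> nat set \<Rightarrow> bool \<times> nat \<times> nat \<times> nat \<times> bool list" where
  "colour E L u e =
     (let x = Min e; y = Max e in
       (u \<in> e, first_diff x y,
        if u \<in> e then (0, 0, [])
        else if first_diff u y < first_diff u x then view E L u x y else view E L u y x))"

lemma colour_fst: "fst (colour E L u e) \<longleftrightarrow> u \<in> e"
  by (simp add: colour_def Let_def)

lemma Min_Max_doubleton:
  fixes x y :: "'a :: linorder"
  shows "Min {x, y} = x \<and> Max {x, y} = y \<or> Min {x, y} = y \<and> Max {x, y} = x"
  by (auto simp: min_def max_def)

lemma colour_first_diff: "fst (snd (colour E L u {x, y})) = first_diff x y"
  using Min_Max_doubleton[of x y] by (auto simp: colour_def Let_def first_diff_commute)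

lemma colour_view:
  assumes "first_diff u y < first_diff u x" "u \<noteq> x" "u \<noteq> y"
  shows "snd (snd (colour E L u {x, y})) = view E L u x y"
  using Min_Max_doubleton[of x y] assms by (auto simp: colour_def Let_def)

lemma view_eqD:
  assumes "view E L u x y = view E L u x' y'"
  shows "first_diff u x = first_diff u x'" "E y (first_diff u x) = E y' (first_diff u x')"
    "x = x' \<Longrightarrow> j \<in> agree E L u x \<Longrightarrow> bit y j = bit y' j"
  using assms by (auto simp: view_def agree_def)

section \<open>A rainbow view of every triangle with pendant edge\<close>

lemma inj_on_four:
  assumes "f e1 \<noteq> f e2" "f e1 \<noteq> f e3" "f e1 \<noteq> f e4" "f e2 \<noteq> f e3" "f e2 \<noteq> f e4" "f e3 \<noteq> f e4"
  shows "inj_on f {e1, e2, e3, e4}"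
  using assms by (auto simp: inj_on_def)

text \<open>The case that splits alone do not settle; the letters and bits of \<open>view\<close>
  serve only here.\<close>

lemma split_contradiction:
  assumes dist: "distinct [a, b, c, d]" and bd: "a < 2 ^ L" "d < 2 ^ L"
    and d: "first_diff d b = first_diff d c"
    and c: "colour E L c {b, d} = colour E L c {a, b}"
    and a: "colour E L a {b, d} = colour E L a {c, d}"
  shows False
proof -
  define i where "i = first_diff b d"
  have bd_i: "first_diff d b = i" "first_diff d c = i" "first_diff c d = i"
    using d by (auto simp: i_def first_diff_commute)
  have ab: "first_diff a b = i" "first_diff b a = i"
    using colour_first_diff[of E L c] c by (metis i_def first_diff_commute)+
  have bc: "i < first_diff b c" using first_diff_gt[of d b c] dist bd_i by auto
  have ad: "i < first_diff a d" using first_diff_gt[of b a d] dist ab by (auto simp: i_def)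
  have ac: "first_diff a c = i" "first_diff c a = i"
    using first_diff_isosceles[of a b c] dist ab bc by (auto simp: first_diff_commute)
  \<comment> \<open>\<open>b\<close> is the endpoint near \<open>c\<close> on both \<open>bd\<close>
    and \<open>ba\<close>, so both views list bits at the same places.\<close>
  have "view E L c b d = view E L c b a"
    using c bc bd_i ac dist colour_view[of c d b E L] colour_view[of c a b E L]
    by (auto simp: first_diff_commute insert_commute)
  moreover have "view E L a d b = view E L a d c"
    using a ad ab ac dist colour_view[of a b d E L] colour_view[of a c d E L]
    by (auto simp: first_diff_commute insert_commute)
  then have "first_diff a d \<in> agree E L c b"
    using view_eqD(2)[of E L a d b d c] first_diff_less[of a d L] dist bd by (auto simp: agree_def)
  ultimately have "bit d (first_diff a d) = bit a (first_diff a d)"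
    by (rule view_eqD(3)[OF _ refl])
  then show False using bit_first_diff[of a d] dist by auto
qed

lemma colour_rainbow:
  assumes dist: "distinct [a, b, c, d]" and bounds: "a < 2 ^ L" "b < 2 ^ L" "c < 2 ^ L" "d < 2 ^ L"
  shows "\<exists>u\<in>{a, b, c, d}. inj_on (colour E L u) {{a, b}, {b, c}, {b, d}, {c, d}}"
proof (rule ccontr)
  let ?C = "colour E L" and ?\<delta> = first_diff
  assume neg: "\<not> ?thesis"
  have flag: "u \<in> e \<longleftrightarrow> u \<in> e'" if "?C u e = ?C u e'" for u e e'
    using that colour_fst by metis
  have delta: "?\<delta> x y = ?\<delta> z w" if "?C u {x, y} = ?C u {z, w}" for u x y z w
    using that colour_first_diff by metis
  \<comment> \<open>The flag stops edges at the observer from matching the others. For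
    \<open>a\<close> this leaves collisions within the triangle; for \<open>c\<close> only
    \<open>bc\<close> with \<open>cd\<close> or \<open>bd\<close> with \<open>ab\<close>; for
    \<open>d\<close> likewise.\<close>
  have A: "?C a {b, c} = ?C a {b, d} \<or> ?C a {b, c} = ?C a {c, d} \<or> ?C a {b, d} = ?C a {c, d}"
  proof (rule ccontr)
    assume "\<not> ?thesis"
    then have "inj_on (?C a) {{a, b}, {b, c}, {b, d}, {c, d}}"
      using dist by (intro inj_on_four) (auto dest: flag)
    with neg show False by blast
  qed
  have C: "?\<delta> c b = ?\<delta> c d \<or> ?C c {b, d} = ?C c {a, b}"
  proof (rule ccontr)
    assume "\<not> ?thesis"
    then have "inj_on (?C c) {{a, b}, {b, c}, {b, d}, {c, d}}"
      using dist delta[of c b c c d]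
      by (intro inj_on_four) (auto dest: flag simp: first_diff_commute)
    with neg show False by blast
  qed
  have D: "?\<delta> d b = ?\<delta> d c \<or> ?C d {b, c} = ?C d {a, b}"
  proof (rule ccontr)
    assume "\<not> ?thesis"
    then have "inj_on (?C d) {{a, b}, {b, c}, {b, d}, {c, d}}"
      using dist delta[of d b d c d]
      by (intro inj_on_four) (auto dest: flag simp: first_diff_commute)
    with neg show False by blast
  qed
  note [simp] = first_diff_commute[of b a] first_diff_commute[of c a] first_diff_commute[of d a]
    first_diff_commute[of c b] first_diff_commute[of d b] first_diff_commute[of d c]
  have not_both: "\<not> (?\<delta> c b = ?\<delta> c d \<and> ?\<delta> d b = ?\<delta> d c)"
    using first_diff_gt[of b c d] dist by auto
  consider "?\<delta> d b = ?\<delta> d c" "?C c {b, d} = ?C c {a, b}"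
    | "?\<delta> c b = ?\<delta> c d" "?C d {b, c} = ?C d {a, b}"
    | "?C c {b, d} = ?C c {a, b}" "?C d {b, c} = ?C d {a, b}"
    using C D not_both by blast
  then show False
  proof cases
    case 1
    then have "?\<delta> b d < ?\<delta> b c" "?\<delta> b d = ?\<delta> c d"
      using first_diff_gt[of d b c] dist by auto
    \<comment> \<open>The split of \<open>bc\<close> differs from those of \<open>bd\<close> and
      \<open>cd\<close>, so only the latter two can collide at \<open>a\<close>.\<close>
    then have "?C a {b, d} = ?C a {c, d}"
      using A delta[of a b c b d] delta[of a b c c d] by auto
    then show False using split_contradiction[of a b c d L E] dist bounds 1 by blast
  next
    case 2
    then have "?\<delta> b c < ?\<delta> b d" "?\<delta> b c = ?\<delta> c d"
      using first_diff_gt[of c b d] dist by auto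
    then have "?C a {b, c} = ?C a {d, c}"
      using A delta[of a b c b d] delta[of a b d c d] by (auto simp: insert_commute)
    then show False using split_contradiction[of a b d c L E] dist bounds 2 by auto
  next
    case 3
    \<comment> \<open>Here \<open>b\<close> splits off first from \<open>a\<close>, \<open>c\<close>
      and \<open>d\<close>; the near endpoints seen from \<open>a\<close> and \<open>c\<close> then
      force three equal splits among \<open>a\<close>, \<open>c\<close>, \<open>d\<close>.\<close>
    define i where "i = ?\<delta> b c"
    have i: "?\<delta> b c = i" "?\<delta> b d = i" "?\<delta> a b = i"
      using delta[OF 3(1)] delta[OF 3(2)] by (auto simp: i_def)
    have gt: "i < ?\<delta> c d" "i < ?\<delta> a c" "i < ?\<delta> a d"
      using first_diff_gt[of b c d] first_diff_gt[of b a c] first_diff_gt[of b a d] dist i by auto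
    have "?C a {b, c} = ?C a {b, d}"
      using A delta[of a b c c d] delta[of a b d c d] i gt by auto
    then have "?\<delta> a c = ?\<delta> a d"
      using colour_view[of a b c E L] colour_view[of a b d E L] i gt dist
      by (auto simp: insert_commute dest!: view_eqD(1))
    moreover have "?\<delta> c d = ?\<delta> c a"
      using 3(1) colour_view[of c b d E L] colour_view[of c b a E L] i gt dist
      by (auto simp: insert_commute dest!: view_eqD(1))
    ultimately show False
      using first_diff_gt[of a c d] dist by auto
  qed
qed

section \<open>Copies of \<open>T_p\<close> in the complete graph\<close>

lemma copy_T_p:
  assumes "subgraph T G" "isomorphic T T_p"
  obtains a b c d where "distinct [a, b, c, d]" "verts T = {a, b, c, d}"
    "edges T = {{a, b}, {b, c}, {b, d}, {c, d}}"
proof -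
  from assms(2) obtain \<phi> where bij: "bij_betw \<phi> (verts T) {0, 1, 2, 3}"
    and iso: "\<And>x y. \<lbrakk>x \<in> verts T; y \<in> verts T\<rbrakk> \<Longrightarrow> {x, y} \<in> edges T \<longleftrightarrow> {\<phi> x, \<phi> y} \<in> edges T_p"
    unfolding isomorphic_def by (auto simp: T_p_def)
  define \<psi> where "\<psi> = inv_into (verts T) \<phi>"
  have \<psi>: "\<phi> (\<psi> i) = i" if "i \<in> {0, 1, 2, 3}" for i
    using bij that unfolding \<psi>_def by (intro bij_betw_inv_into_right)
  have V: "verts T = {\<psi> 0, \<psi> 1, \<psi> 2, \<psi> 3}"
    using bij_betw_imp_surj_on[OF bij_betw_inv_into[OF bij]] by (simp add: \<psi>_def)
  have dist: "distinct [\<psi> 0, \<psi> 1, \<psi> 2, \<psi> 3]"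
    using \<psi>[of 0] \<psi>[of 1] \<psi>[of 2] \<psi>[of 3] by (auto simp del: One_nat_def)
  have E: "{\<psi> i, \<psi> j} \<in> edges T \<longleftrightarrow> {i, j} \<in> edges T_p"
    if "i \<in> {0, 1, 2, 3}" "j \<in> {0, 1, 2, 3}" for i j
    using iso[of "\<psi> i" "\<psi> j"] V \<psi>[OF that(1)] \<psi>[OF that(2)] that by auto
  have "edges T = {{\<psi> 0, \<psi> 1}, {\<psi> 1, \<psi> 2}, {\<psi> 1, \<psi> 3}, {\<psi> 2, \<psi> 3}}"
  proof (intro equalityI subsetI)
    fix e assume e: "e \<in> edges T"
    \<comment> \<open>\<open>isomorphic\<close> tests pairs only; that all edges are pairs comes
      from \<open>simple_graph\<close>.\<close>
    with assms(1) have "e \<subseteq> verts T" "card e = 2"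
      by (auto simp: subgraph_def simple_graph_def)
    then obtain x y where xy: "e = {x, y}" "x \<in> verts T" "y \<in> verts T"
      by (auto simp: card_2_iff)
    then obtain i j where ij: "e = {\<psi> i, \<psi> j}" "i \<in> {0, 1, 2, 3}" "j \<in> {0, 1, 2, 3}"
      unfolding V by blast
    then have "{i, j} \<in> edges T_p" using E e by blast
    then show "e \<in> {{\<psi> 0, \<psi> 1}, {\<psi> 1, \<psi> 2}, {\<psi> 1, \<psi> 3}, {\<psi> 2, \<psi> 3}}"
      unfolding ij(1) T_p_def by (auto simp: doubleton_eq_iff)
  next
    fix e assume "e \<in> {{\<psi> 0, \<psi> 1}, {\<psi> 1, \<psi> 2}, {\<psi> 1, \<psi> 3}, {\<psi> 2, \<psi> 3}}"
    then show "e \<in> edges T" using E by (auto simp: T_p_def)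
  qed
  with that dist V show thesis by blast
qed

lemma local_collection_colour:
  assumes "n \<le> 2 ^ L"
  shows "local_collection n T_p (\<lambda>u e. to_nat (colour E L u e))"
  unfolding local_collection_def
proof (intro allI impI)
  fix T assume T: "subgraph T (complete_graph n) \<and> isomorphic T T_p"
  then obtain a b c d where *: "distinct [a, b, c, d]" "verts T = {a, b, c, d}"
    "edges T = {{a, b}, {b, c}, {b, d}, {c, d}}"
    using copy_T_p by metis
  have "\<forall>v\<in>{a, b, c, d}. v < 2 ^ L"
    using T *(2) assms by (auto simp: subgraph_def complete_graph_def)
  then obtain u where "u \<in> verts T" "inj_on (colour E L u) (edges T)"
    using colour_rainbow[OF *(1)] * by (metis insertCI)
  then show "\<exists>u\<in>verts T. inj_on (\<lambda>e. to_nat (colour E L u e)) (edges T)"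
    by (auto simp: inj_on_def)
qed

section \<open>Counting colours\<close>

lemma sum_power_2_le: "(\<Sum>i\<le>r. 2 ^ i) \<le> (2::nat) ^ Suc r"
  by (induction r) auto

lemma card_colours:
  assumes "n \<le> 2 ^ L" "n \<le> B ^ r" "0 < B" "u < n"
  shows "card (colour (code B r) L u ` edges (complete_graph n))
           \<le> 2 * (L * (L * (B * L ^ r * 2 ^ Suc r)))"
proof -
  let ?lists = "{bs :: bool list. set bs \<subseteq> UNIV \<and> length bs \<le> r}"
  let ?S = "(UNIV :: bool set) \<times> {..<L} \<times> {..<L} \<times> {..<B * L ^ r} \<times> ?lists"
  have fin: "finite ?lists" by (rule finite_lists_length_le) simp
  have "card ?lists \<le> 2 ^ Suc r"
    using card_lists_length_le[of "UNIV :: bool set" r] sum_power_2_le[of r] by simp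
  then have card: "card ?S \<le> 2 * (L * (L * (B * L ^ r * 2 ^ Suc r)))"
    by (auto simp: card_cartesian_product)
  have view: "view (code B r) L u x y \<in> {..<L} \<times> {..<B * L ^ r} \<times> ?lists"
    if "x \<noteq> u" "x < n" for x y
    using first_diff_less[of u x L] code_less[OF assms(3)] card_agree_code[of u x B r L] that assms
    by (auto simp: view_def)
  have "colour (code B r) L u ` edges (complete_graph n) \<subseteq> ?S"
  proof (intro image_subsetI)
    fix e assume "e \<in> edges (complete_graph n)"
    then obtain x y where e: "e = {x, y}" "x \<noteq> y" "x < n" "y < n"
      by (auto simp: complete_graph_def card_2_iff)
    have xy: "first_diff x y < L" "first_diff y x < L"
      using e assms by (auto intro!: first_diff_less)
    \<comment> \<open>The default \<open>(0, 0, [])\<close> for edges at \<open>u\<close> must lie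
      in \<open>?S\<close> too.\<close>
    then have "0 < L" by simp
    then have L: "0 < L" "0 < B * L ^ r" using assms by auto
    show "colour (code B r) L u e \<in> ?S"
      using Min_Max_doubleton[of x y] view[of x y] view[of y x] e xy L
      unfolding colour_def Let_def by (auto split: if_splits)
  qed
  then have "card (colour (code B r) L u ` edges (complete_graph n)) \<le> card ?S"
    using fin by (intro card_mono) auto
  with card show ?thesis by linarith
qed

text \<open>The lower bound will make \<open>ln (g n T_p)\<close> nonnegative.\<close>

lemma g_T_p_bounds:
  assumes "n \<le> 2 ^ L" "n \<le> B ^ r" "2 \<le> n" "0 < B"
  shows "g n T_p \<le> 2 * (L * (L * (B * L ^ r * 2 ^ Suc r)))" "1 \<le> g n T_p"
proof -
  let ?P = "\<lambda>k. \<exists>f. local_collection n T_p f \<and>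
     (\<forall>v\<in>verts (complete_graph n). card (f v ` edges (complete_graph n)) \<le> k)"
  let ?k = "2 * (L * (L * (B * L ^ r * 2 ^ Suc r)))"
  have "card ((\<lambda>e. to_nat (colour (code B r) L u e)) ` edges (complete_graph n)) \<le> ?k"
    if "u \<in> verts (complete_graph n)" for u
  proof -
    have "(\<lambda>e. to_nat (colour (code B r) L u e)) ` edges (complete_graph n) =
        to_nat ` colour (code B r) L u ` edges (complete_graph n)"
      by (auto simp: image_image)
    then show ?thesis
      using card_colours[of n L B r u] assms that by (simp add: card_image complete_graph_def)
  qed
  then have P: "?P ?k" using local_collection_colour[OF assms(1)] by blast
  then show "g n T_p \<le> ?k" unfolding g_def by (rule Least_le)
  from P have "?P (g n T_p)" unfolding g_def by (rule LeastI)
  then obtain f :: "nat \<Rightarrow> nat set \<Rightarrow> nat"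
    where "\<forall>v\<in>verts (complete_graph n). card (f v ` edges (complete_graph n)) \<le> g n T_p"
    by blast
  moreover have "0 \<in> verts (complete_graph n)" using assms by (simp add: complete_graph_def)
  ultimately have f: "card (f 0 ` edges (complete_graph n)) \<le> g n T_p" by (rule bspec)
  have "{0, 1} \<in> edges (complete_graph n)" "finite (edges (complete_graph n))"
    using assms by (auto simp: complete_graph_def)
  then have "0 < card (f 0 ` edges (complete_graph n))"
    by (auto simp: card_gt_0_iff)
  with f show "1 \<le> g n T_p" by linarith
qed

section \<open>Asymptotics\<close>

lemma g_T_p_le_powr:
  assumes "0 < r"
  shows "\<forall>\<^sub>F n in sequentially. real (g n T_p) \<le> real n powr (2 / real r)"
proof -
  \<comment> \<open>The colour count with both ceilings replaced by adding 1. Its order is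
    \<open>x powr (1 / r)\<close> times a power of the logarithm, which the doubled exponent
    absorbs.\<close>
  define F where "F x = 2 * ((log 2 x + 1) powr (real r + 2) * ((x powr (1 / real r) + 1) * 2 ^ Suc r))"
    for x :: real
  have "\<forall>\<^sub>F n in sequentially. F (real n) \<le> real n powr (2 / real r)"
  proof -
    have "\<forall>\<^sub>F x in at_top. 2 * ((log 2 x + 1) powr k * ((x powr s + 1) * c)) \<le> x powr (2 * s)"
      if "0 < s" "0 < c" "0 < k" for s c k :: real
      using that by real_asymp
    from this[of "1 / real r" "2 ^ Suc r" "real r + 2"] assms show ?thesis
      unfolding F_def by (auto intro: eventually_compose_filterlim[OF _ filterlim_real_sequentially])
  qed
  moreover have "\<forall>\<^sub>F n in sequentially. real (g n T_p) \<le> F (real n)"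
    using eventually_ge_at_top[of 2]
  proof eventually_elim
    case (elim n)
    define L where "L = nat \<lceil>log 2 (real n)\<rceil>"
    define B where "B = nat \<lceil>real n powr (1 / real r)\<rceil>"
    have log: "0 < log 2 (real n)" using elim by simp
    have L: "log 2 (real n) \<le> real L" "real L \<le> log 2 (real n) + 1"
      unfolding L_def using log by linarith+
    have B: "real n powr (1 / real r) \<le> real B" "real B \<le> real n powr (1 / real r) + 1"
      unfolding B_def using powr_ge_zero[of "real n" "1 / real r"] by linarith+
    have "0 < real n powr (1 / real r)" using elim by simp
    then have "0 < B" using B(1) by linarith
    have "0 < L" using L(1) log by linarith
    have "real n \<le> 2 powr real L" using L(1) elim by (simp add: log_le_iff)
    then have "real n \<le> real (2 ^ L)" by (simp add: powr_realpow)
    then have nL: "n \<le> 2 ^ L" by linarith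
    have "real n = (real n powr (1 / real r)) ^ r"
      using elim assms by (simp add: powr_powr flip: powr_realpow)
    also have "\<dots> \<le> real B ^ r" using B(1) by (intro power_mono) auto
    finally have nB: "n \<le> B ^ r" by (metis of_nat_le_iff of_nat_power)
    have "real (g n T_p) \<le> real (2 * (L * (L * (B * L ^ r * 2 ^ Suc r))))"
      using g_T_p_bounds(1)[OF nL nB elim \<open>0 < B\<close>] by (rule of_nat_mono)
    also have "\<dots> = 2 * (real L ^ (r + 2) * (real B * 2 ^ Suc r))"
      by (simp add: power_add power2_eq_square)
    also have "real L ^ (r + 2) = real L powr (real r + 2)"
      using \<open>0 < L\<close> by (simp add: powr_add powr_realpow power_add power2_eq_square)
    also have "2 * (real L powr (real r + 2) * (real B * 2 ^ Suc r)) \<le> F (real n)"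
      unfolding F_def using L B log by (intro mult_mono powr_mono2) auto
    finally show ?case .
  qed
  ultimately show ?thesis by eventually_elim linarith
qed

theorem theorem2p2:
  "\<exists>h :: nat \<Rightarrow> real. h \<in> o(\<lambda>_. 1) \<and>
     (\<forall>\<^sub>F n in sequentially. real (g n T_p) = real n powr h n)"
proof (intro exI conjI)
  define h where "h n = ln (real (g n T_p)) / ln (real n)" for n
  have g1: "1 \<le> g n T_p" if "2 \<le> n" for n
    \<comment> \<open>Any admissible parameters do for the lower bound, here \<open>L = n\<close>,
      \<open>B = n\<close>, \<open>r = 1\<close>.\<close>
    using g_T_p_bounds(2)[of n n n 1] that by (simp add: less_imp_le)
  show "\<forall>\<^sub>F n in sequentially. real (g n T_p) = real n powr h n"
    using eventually_ge_at_top[of 2]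
  proof eventually_elim
    case (elim n)
    then show ?case using g1[OF elim] by (simp add: h_def powr_def)
  qed
  have "h \<longlonglongrightarrow> 0"
  proof (rule LIMSEQ_I)
    fix e :: real assume "0 < e"
    then obtain r :: nat where r: "0 < r" "2 / real r < e"
    proof -
      obtain r :: nat where r: "2 / e < real r" using reals_Archimedean2 by blast
      with \<open>0 < e\<close> have "0 < real r" by (meson divide_pos_pos less_trans zero_less_numeral)
      with r \<open>0 < e\<close> show thesis by (intro that[of r]) (simp_all add: field_simps)
    qed
    have "\<forall>\<^sub>F n in sequentially. norm (h n - 0) < e"
      using g_T_p_le_powr[OF r(1)] eventually_ge_at_top[of 2]
    proof eventually_elim
      case (elim n)
      have g: "1 \<le> real (g n T_p)" using g1[OF elim(2)] by simp
      then have "ln (real (g n T_p)) \<le> ln (real n powr (2 / real r))"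
        using elim(1) by (intro ln_mono) auto
      also have "\<dots> = 2 / real r * ln (real n)"
        using elim by (simp add: ln_powr)
      finally have "h n \<le> 2 / real r"
        using elim by (simp add: h_def pos_divide_le_eq)
      moreover have "0 \<le> h n" using g elim by (simp add: h_def)
      ultimately show ?case using r(2) by simp
    qed
    then show "\<exists>N. \<forall>n\<ge>N. norm (h n - 0) < e" by (simp add: eventually_sequentially)
  qed
  then show "h \<in> o(\<lambda>_. 1)" by (intro smalloI_tendsto) auto
qed

end
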